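(* Let $P$ be the true transition kernel of a discounted MDP on a metric state space $(\mathscr S,d)$ with discount $\gamma\in(0,1)$. Let $\Pi$ be a policy class, $\mathscr M$ a class of candidate kernels, and let $d_{\mathrm{data}}$ be a distribution on state-action pairs satisfying $\kappa$-coverage: $d_\pi(s,a)\le\kappa\,d_{\mathrm{data}}(s,a)$ for all $(s,a)$ and all $\pi\in\Pi$. Suppose that for every $\hat P\in\mathscr M$ and every $\pi\in\Pi$ the value function $V_\pi^{\hat P}$ is $L_v$-Lipschitz with respect to $d$. Let $\mathcal D_{\mathrm{Lip}}$ be a class of critics approximating the 1-Lipschitz ball, let $$J_{\mathcal D_{\mathrm{Lip}}}(\hat P)=\mathbb E_{(s,a)\sim d_{\mathrm{data}}}\Big[\sup_{D\in\mathcal D_{\mathrm{Lip}}}\Delta_{D,\hat P}(s,a)\Big]$$ be the value of the Wasserstein-critic game, and let $\epsilon_{\mathrm{critic}}\ge0$ be the error from approximating the 1-Lipschitz ball with $\mathcal D_{\mathrm{Lip}}$ (see context). If $\hat P^*\in\mathscr M$ achieves $J_{\mathcal D_{\mathrm{Lip}}}(\hat P^* )\le\epsilon_{\mathrm{model}}$, then $$\sup_{\pi\in\Pi}|V_\pi(P)-V_\pi(\hat P^* )|\le\gamma L_v\kappa\,(\epsilon_{\mathrm{model}}+\epsilon_{\mathrm{critic}}).$$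
   Context: An MDP has state space $\mathscr S$, action space $\mathscr A$, transition kernel $P(\cdot\mid s,a)$, known reward $r(s,a)\in[0,R_{\max}]$, discount $\gamma$ and initial state law $\rho_0$. For a kernel $Q$ and policy $\pi$, $V_\pi^{Q}(s)=\mathbb E[\sum_{t\ge0}\gamma^tr(s_t,a_t)\mid s_0=s]$ when actions follow $\pi$ and transitions follow $Q$, and $V_\pi(Q)=\mathbb E_{s_0\sim\rho_0}[V_\pi^Q(s_0)]$. $d_\pi(s,a)=\mathbb E[\sum_{t\ge0}\gamma^t\mathbf 1\{(s_t,a_t)=(s,a)\}]$ is the unnormalized discounted occupancy of $\pi$ under the true kernel $P$ (in general spaces, the coverage inequality is between measures). For a critic $D(s,a,s')$, $\Delta_{D,\hat P}(s,a)=\mathbb E_{s'\sim P(\cdot\mid s,a)}[D(s,a,s')]-\mathbb E_{s'\sim\hat P(\cdot\mid s,a)}[D(s,a,s')]$. The critic approximation error is such that for every $\hat P\in\mathscr M$, $$\mathbb E_{d_{\mathrm{data}}}\Big[\sup_{D}\Delta_{D,\hat P}(s,a)\Big]\le\mathbb E_{d_{\mathrm{data}}}\Big[\sup_{D\in\mathcal D_{\mathrm{Lip}}}\Delta_{D,\hat P}(s,a)\Big]+\epsilon_{\mathrm{critic}},$$ where the supremum on the left is over critics $D$ with $D(s,a,\cdot)$ 1-Lipschitz on $(\mathscr S,d)$. *)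

theory Defs
  imports "HOL-Probability.Probability"
begin

text \<open>
  States are the points of a metric space type with its Borel sets; actions live in an arbitrary
  measurable space \<open>A\<close>. Transition kernels are measurable maps into \<open>prob_algebra borel\<close>,
  (stationary, randomized) policies are measurable maps into \<open>prob_algebra A\<close>.
\<close>

type_synonym ('s, 'a) kernel = "'s \<times> 'a \<Rightarrow> 's measure"
type_synonym ('s, 'a) policy = "'s \<Rightarrow> 'a measure"
type_synonym ('s, 'a) critic = "'s \<times> 'a \<Rightarrow> 's \<Rightarrow> real"

abbreviation SA :: "'a measure \<Rightarrow> ('s::metric_space \<times> 'a) measure" where
  "SA A \<equiv> borel \<Otimes>\<^sub>M A"

definition is_kernel :: "'a measure \<Rightarrow> ('s::metric_space, 'a) kernel \<Rightarrow> bool" where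
  "is_kernel A Q \<longleftrightarrow> Q \<in> SA A \<rightarrow>\<^sub>M prob_algebra borel"

definition is_policy :: "'a measure \<Rightarrow> ('s::metric_space, 'a) policy \<Rightarrow> bool" where
  "is_policy A \<pi> \<longleftrightarrow> \<pi> \<in> borel \<rightarrow>\<^sub>M prob_algebra A"

text \<open>Law of \<open>(s, a)\<close> when \<open>s\<close> has law \<open>\<mu>\<close> and \<open>a\<close> is drawn from \<open>\<pi> s\<close>.\<close>

definition with_action ::
  "'a measure \<Rightarrow> ('s::metric_space, 'a) policy \<Rightarrow> 's measure \<Rightarrow> ('s \<times> 'a) measure" where
  "with_action A \<pi> \<mu> = \<mu> \<bind> (\<lambda>s. \<pi> s \<bind> (\<lambda>a. return (SA A) (s, a)))"

text \<open>Conditional law of \<open>(s\<^sub>n, a\<^sub>n)\<close> given the pairs at the times before \<open>n\<close>.\<close>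

definition step_law ::
  "'a measure \<Rightarrow> ('s::metric_space, 'a) kernel \<Rightarrow> ('s, 'a) policy \<Rightarrow> 's measure
    \<Rightarrow> nat \<Rightarrow> (nat \<Rightarrow> 's \<times> 'a) \<Rightarrow> ('s \<times> 'a) measure" where
  "step_law A Q \<pi> \<mu> n \<omega> =
     (case n of 0 \<Rightarrow> with_action A \<pi> \<mu> | Suc m \<Rightarrow> with_action A \<pi> (Q (\<omega> m)))"

text \<open>
  The Ionescu-Tulcea law of the trajectory \<open>(s\<^sub>t, a\<^sub>t)\<close>, \<open>t = 0, 1, \<dots>\<close>, with \<open>s\<^sub>0\<close> of law \<open>\<mu>\<close>.
\<close>

definition trajectory ::
  "'a measure \<Rightarrow> ('s::metric_space, 'a) kernel \<Rightarrow> ('s, 'a) policy \<Rightarrow> 's measure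
    \<Rightarrow> (nat \<Rightarrow> 's \<times> 'a) measure" where
  "trajectory A Q \<pi> \<mu> =
     projective_family.lim UNIV (Ionescu_Tulcea.CI (step_law A Q \<pi> \<mu>) (\<lambda>_. SA A)) (\<lambda>_. SA A)"

lemma with_action_measurable:
  assumes "is_policy A \<pi>"
  shows "with_action A \<pi> \<in> prob_algebra borel \<rightarrow>\<^sub>M prob_algebra (SA A)"
proof -
  have [measurable]: "\<pi> \<in> borel \<rightarrow>\<^sub>M prob_algebra A"
    using assms by (simp add: is_policy_def)
  show ?thesis
    unfolding with_action_def by measurable
qed

lemma Ionescu_Tulcea_step_law:
  assumes Q: "is_kernel A Q" and \<pi>: "is_policy A \<pi>" and \<mu>: "\<mu> \<in> space (prob_algebra borel)"
  shows "Ionescu_Tulcea (step_law A Q \<pi> \<mu>) (\<lambda>_. SA A)"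
proof -
  note [measurable] = with_action_measurable[OF \<pi>]
  have [measurable]: "Q \<in> SA A \<rightarrow>\<^sub>M prob_algebra borel"
    using Q by (simp add: is_kernel_def)
  have *: "step_law A Q \<pi> \<mu> i \<in> PiM {0..<i} (\<lambda>_. SA A) \<rightarrow>\<^sub>M prob_algebra (SA A)" for i
  proof (cases i)
    case 0
    then show ?thesis
      unfolding step_law_def using measurable_space[OF with_action_measurable[OF \<pi>] \<mu>] by simp
  next
    case (Suc m)
    have [measurable]: "(\<lambda>\<omega>. \<omega> m) \<in> PiM {0..<Suc m} (\<lambda>_. SA A) \<rightarrow>\<^sub>M SA A"
      by (rule measurable_component_singleton) simp
    show ?thesis
      unfolding step_law_def Suc by simp
  qed
  have "step_law A Q \<pi> \<mu> i x \<in> space (prob_algebra (SA A))"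
    if "x \<in> space (PiM {0..<i} (\<lambda>_. SA A))" for i x
    using measurable_space[OF *] that by blast
  then have "prob_space (step_law A Q \<pi> \<mu> i x)"
    if "x \<in> space (PiM {0..<i} (\<lambda>_. SA A))" for i x
    using that unfolding space_prob_algebra by blast
  then show ?thesis
    using * by (intro Ionescu_Tulcea.intro measurable_prob_algebraD)
qed

definition value_fun ::
  "'a measure \<Rightarrow> real \<Rightarrow> ('s::metric_space \<times> 'a \<Rightarrow> real) \<Rightarrow> ('s, 'a) kernel
    \<Rightarrow> ('s, 'a) policy \<Rightarrow> 's \<Rightarrow> real" where
  "value_fun A \<gamma> r Q \<pi> s = (\<integral>\<omega>. (\<Sum>t. \<gamma> ^ t * r (\<omega> t)) \<partial>trajectory A Q \<pi> (return borel s))"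

definition policy_value ::
  "'a measure \<Rightarrow> real \<Rightarrow> ('s::metric_space \<times> 'a \<Rightarrow> real) \<Rightarrow> 's measure \<Rightarrow> ('s, 'a) kernel
    \<Rightarrow> ('s, 'a) policy \<Rightarrow> real" where
  "policy_value A \<gamma> r \<rho> Q \<pi> = (\<integral>s. value_fun A \<gamma> r Q \<pi> s \<partial>\<rho>)"

text \<open>The unnormalized discounted occupancy, as a set function on measurable sets of pairs.\<close>

definition occupancy ::
  "'a measure \<Rightarrow> real \<Rightarrow> 's measure \<Rightarrow> ('s::metric_space, 'a) kernel \<Rightarrow> ('s, 'a) policy
    \<Rightarrow> ('s \<times> 'a) set \<Rightarrow> real" where
  "occupancy A \<gamma> \<rho> Q \<pi> B = (\<integral>\<omega>. (\<Sum>t. \<gamma> ^ t * indicator B (\<omega> t)) \<partial>trajectory A Q \<pi> \<rho>)"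

definition critic_gap ::
  "('s::metric_space, 'a) kernel \<Rightarrow> ('s, 'a) kernel \<Rightarrow> ('s, 'a) critic \<Rightarrow> 's \<times> 'a \<Rightarrow> real" where
  "critic_gap P Q D x = (\<integral>s'. D x s' \<partial>P x) - (\<integral>s'. D x s' \<partial>Q x)"

text \<open>
  The supremum at \<open>x = (s, a)\<close> runs over the critics of the class for which both expectations exist;
  the Bochner integral of a non-integrable function is 0 and must not contribute. The value may be
  infinite (Wasserstein distances can be), hence \<open>ereal\<close>.
\<close>

definition sup_gap ::
  "('s::metric_space, 'a) kernel \<Rightarrow> ('s, 'a) kernel \<Rightarrow> ('s, 'a) critic set \<Rightarrow> 's \<times> 'a \<Rightarrow> ereal" where
  "sup_gap P Q \<D> x =
     (SUP D\<in>{D \<in> \<D>. integrable (P x) (D x) \<and> integrable (Q x) (D x)}. ereal (critic_gap P Q D x))"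

definition lip_critics :: "('s::metric_space, 'a) critic set" where
  "lip_critics = {D. \<forall>x. 1-lipschitz_on UNIV (D x)}"

text \<open>
  Expectation of an extended real function. If both parts are infinite the value is \<open>\<infinity>\<close>, so a
  finite upper bound on \<open>expect M f\<close> forces the positive part to have finite expectation.
\<close>

definition expect :: "'b measure \<Rightarrow> ('b \<Rightarrow> ereal) \<Rightarrow> ereal" where
  "expect M f =
     enn2ereal (\<integral>\<^sup>+x. e2ennreal (f x) \<partial>M) - enn2ereal (\<integral>\<^sup>+x. e2ennreal (- f x) \<partial>M)"

definition game_value ::
  "('s::metric_space \<times> 'a) measure \<Rightarrow> ('s, 'a) kernel \<Rightarrow> ('s, 'a) critic set
    \<Rightarrow> ('s, 'a) kernel \<Rightarrow> ereal" where
  "game_value d_data P \<D> Q = expect d_data (sup_gap P Q \<D>)"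

end

(* Write V for the value function of Pstar and m_t for the law of (s_t, a_t) under P. With
   b_t the m_t-expectation of r + \<gamma> Pstar V, the Bellman equation gives b_0 = V(Pstar) and
   b_(t+1) = E_(m_t)[P V], so that telescoping \<gamma>^t b_t yields
     V(P) - V(Pstar) = \<gamma> (sum over t of \<gamma>^t E_(m_t)[(P - Pstar) V]).
   Coverage replaces the discounted sum by \<kappa> times an expectation under d_data, and
   V / L\<^sub>v and -V / L\<^sub>v are admissible critics, so |(P - Pstar) V| is at most L\<^sub>v times the sup gap. *)

theory Submission
  imports Defs
begin

subsection \<open>Bounded functions and probability kernels\<close>

text \<open>The number b_t is a hybrid value: pairs follow \<open>P\<close> up to time t, and all
  later transitions follow \<open>Pstar\<close>. Each summand of the series is the cost of moving
  the switch by one step, and the factor \<gamma> is there because a changed transition is felt one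
  step later. Hence states are visited under \<open>P\<close>, which is where coverage is assumed,
  while the function being tested is a value under the model, which is where the Lipschitz bound is
  assumed. Values and occupancies are integrals over paths, but of sums of functions of a single
  coordinate, so the one-time marginals of the path law carry the whole argument. Two obstacles
  shape the rest. Coverage compares set functions and has to be extended to nonnegative functions.
  The sup gap is a supremum over a possibly uncountable class; it may be infinite and need not be
  measurable, so it is only bounded below, by the measurable function |(P - Pstar) V| divided by the
  Lipschitz constant. Bounded rewards keep V within \<open>R_max / (1 - \<gamma>)\<close>, so that
  no Bochner integral of V takes its default value.\<close>

lemma integrable_prob_algebra_bounded:
  fixes f :: "'b \<Rightarrow> real"
  assumes M: "M \<in> space (prob_algebra N)" and f: "f \<in> borel_measurable N"
    and B: "\<And>x. x \<in> space N \<Longrightarrow> \<bar>f x\<bar> \<le> B"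
  shows "integrable M f"
proof -
  have M': "prob_space M" "sets M = sets N"
    using M by (auto simp: space_prob_algebra)
  interpret prob_space M by (rule M')
  show ?thesis
    using B f by (intro integrable_const_bound[of _ B])
      (auto simp: sets_eq_imp_space_eq[OF M'(2)] measurable_cong_sets[OF M'(2) refl])
qed

lemma abs_integral_prob_algebra_le:
  fixes f :: "'b \<Rightarrow> real"
  assumes M: "M \<in> space (prob_algebra N)" and f: "f \<in> borel_measurable N"
    and B: "\<And>x. x \<in> space N \<Longrightarrow> \<bar>f x\<bar> \<le> B"
  shows "\<bar>\<integral>x. f x \<partial>M\<bar> \<le> B"
proof -
  have M': "prob_space M" "sets M = sets N"
    using M by (auto simp: space_prob_algebra)
  interpret prob_space M by (rule M')
  have "\<bar>\<integral>x. f x \<partial>M\<bar> \<le> (\<integral>x. \<bar>f x\<bar> \<partial>M)"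
    by (rule integral_abs_bound)
  also have "\<dots> \<le> (\<integral>x. B \<partial>M)"
    using integrable_prob_algebra_bounded[OF M f B] B
    by (intro integral_mono) (auto simp: sets_eq_imp_space_eq[OF M'(2)])
  finally show ?thesis
    by (simp add: prob_space)
qed

section \<open>Integration against kernels and composition of kernels\<close>

lemma measurable_integral_kernel:
  fixes f :: "'b \<Rightarrow> real"
  assumes "K \<in> M \<rightarrow>\<^sub>M prob_algebra N" "f \<in> borel_measurable N"
  shows "(\<lambda>x. \<integral>y. f y \<partial>K x) \<in> borel_measurable M"
  using measurable_prob_algebraD[OF assms(1)] integral_measurable_subprob_algebra[OF assms(2)]
  by (rule measurable_compose)

lemma integral_bind_prob_algebra:
  fixes f :: "'b \<Rightarrow> real"
  assumes M: "M \<in> space (prob_algebra L)" and K: "K \<in> L \<rightarrow>\<^sub>M prob_algebra N"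
    and f: "f \<in> borel_measurable N" and B: "\<And>x. x \<in> space N \<Longrightarrow> \<bar>f x\<bar> \<le> B"
  shows "(\<integral>y. f y \<partial>(M \<bind> K)) = (\<integral>x. \<integral>y. f y \<partial>K x \<partial>M)"
proof -
  have M': "prob_space M" "sets M = sets L"
    using M by (auto simp: space_prob_algebra)
  interpret prob_space M by (rule M')
  have K': "K \<in> M \<rightarrow>\<^sub>M prob_algebra N"
    using K by (simp add: measurable_cong_sets[OF M'(2) refl])
  show ?thesis
  proof (rule integral_bind[OF f B measurable_prob_algebraD[OF K']])
    show "AE x in M. emeasure (K x) (space (K x)) \<le> ennreal 1"
      using measurable_space[OF K'] by (auto simp: space_prob_algebra intro!: prob_space.measure_le_1)
  qed (unfold_locales)
qed

lemma bind_in_space_prob_algebra: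
  assumes "M \<in> space (prob_algebra L)" "K \<in> L \<rightarrow>\<^sub>M prob_algebra N"
  shows "M \<bind> K \<in> space (prob_algebra N)"
  using prob_space_bind'[OF assms] sets_bind'[OF assms] by (simp add: space_prob_algebra)

lemma bind_assoc_prob_algebra:
  assumes M: "M \<in> space (prob_algebra L)" and f: "f \<in> L \<rightarrow>\<^sub>M prob_algebra N"
    and g: "g \<in> N \<rightarrow>\<^sub>M prob_algebra R"
  shows "M \<bind> f \<bind> g = M \<bind> (\<lambda>x. f x \<bind> g)"
proof -
  have "f \<in> M \<rightarrow>\<^sub>M subprob_algebra N"
    using M measurable_prob_algebraD[OF f]
    by (simp add: space_prob_algebra cong: measurable_cong_sets)
  then show ?thesis
    by (rule bind_assoc[OF _ measurable_prob_algebraD[OF g]])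
qed

text \<open>Indicators satisfy the inequality by assumption, and it survives scaling, sums and
  increasing limits, so induction over nonnegative measurable functions applies. This is what turns
  coverage of sets into coverage of expectations; working in \<open>ennreal\<close> postpones every
  question of convergence.\<close>

lemma suminf_nn_integral_le:
  fixes c :: "nat \<Rightarrow> ennreal"
  assumes sets_m: "\<And>t. sets (m t) = sets N"
    and le: "\<And>B. B \<in> sets N \<Longrightarrow> (\<Sum>t. c t * emeasure (m t) B) \<le> K * emeasure N B"
    and u: "u \<in> borel_measurable N"
  shows "(\<Sum>t. c t * (\<integral>\<^sup>+x. u x \<partial>m t)) \<le> K * (\<integral>\<^sup>+x. u x \<partial>N)"
  using u
proof (induction rule: borel_measurable_induct)
  case (cong f g)
  have "(\<integral>\<^sup>+x. f x \<partial>m t) = (\<integral>\<^sup>+x. g x \<partial>m t)" for t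
    using cong(3) by (intro nn_integral_cong) (simp add: sets_eq_imp_space_eq[OF sets_m])
  moreover have "(\<integral>\<^sup>+x. f x \<partial>N) = (\<integral>\<^sup>+x. g x \<partial>N)"
    using cong(3) by (intro nn_integral_cong)
  ultimately show ?case
    using cong.IH by simp
next
  case (set B)
  then show ?case
    using le[OF set] by (simp add: sets_m)
next
  case (mult u d)
  note [measurable] = mult(2)
  have "u \<in> borel_measurable (m t)" for t
    using mult(2) by (simp add: measurable_cong_sets[OF sets_m refl])
  then have "(\<Sum>t. c t * (\<integral>\<^sup>+x. d * u x \<partial>m t)) = d * (\<Sum>t. c t * (\<integral>\<^sup>+x. u x \<partial>m t))"
    by (simp add: nn_integral_cmult mult.left_commute)
  also have "\<dots> \<le> d * (K * (\<integral>\<^sup>+x. u x \<partial>N))"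
    by (intro mult_left_mono mult) simp
  finally show ?case
    by (simp add: nn_integral_cmult mult.left_commute)
next
  case (add u v)
  note [measurable] = add.hyps(1,3)
  have "u \<in> borel_measurable (m t)" "v \<in> borel_measurable (m t)" for t
    using add.hyps(1,3) by (simp_all add: measurable_cong_sets[OF sets_m refl])
  then have "(\<Sum>t. c t * (\<integral>\<^sup>+x. v x + u x \<partial>m t))
      = (\<Sum>t. c t * (\<integral>\<^sup>+x. v x \<partial>m t)) + (\<Sum>t. c t * (\<integral>\<^sup>+x. u x \<partial>m t))"
    by (simp add: nn_integral_add distrib_left suminf_add)
  also have "\<dots> \<le> K * (\<integral>\<^sup>+x. v x \<partial>N) + K * (\<integral>\<^sup>+x. u x \<partial>N)"
    by (intro add_mono add.IH)
  finally show ?case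
    by (simp add: nn_integral_add distrib_left)
next
  case (seq U)
  note [measurable] = seq(1)
  have U: "U i \<in> borel_measurable (m t)" for i t
    using seq(1) by (simp add: measurable_cong_sets[OF sets_m refl])
  have "(\<Sum>t. c t * (\<integral>\<^sup>+x. (SUP i. U i) x \<partial>m t)) = (\<Sum>t. SUP i. c t * (\<integral>\<^sup>+x. U i x \<partial>m t))"
    using U \<open>incseq U\<close>
    by (simp add: nn_integral_monotone_convergence_SUP SUP_mult_left_ennreal image_comp)
  \<comment> \<open>Monotone convergence for the series: each term increases with i.\<close>
  also have "\<dots> = (SUP i. \<Sum>t. c t * (\<integral>\<^sup>+x. U i x \<partial>m t))"
    using \<open>incseq U\<close>
    by (intro ennreal_suminf_SUP_eq)
       (auto simp: incseq_def le_fun_def intro!: mult_left_mono nn_integral_mono)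
  also have "\<dots> \<le> (SUP i. K * (\<integral>\<^sup>+x. U i x \<partial>N))"
    by (intro SUP_mono) (use seq.IH in blast)
  also have "\<dots> = K * (\<integral>\<^sup>+x. (SUP i. U i) x \<partial>N)"
    using \<open>incseq U\<close> by (simp add: nn_integral_monotone_convergence_SUP SUP_mult_left_ennreal image_comp)
  finally show ?case .
qed

subsection \<open>Marginals of the trajectory\<close>

text \<open>The projective family computes the law on a finite set \<open>J\<close> of coordinates
  from the shortest initial segment containing \<open>J\<close>. When \<open>J\<close> is itself an
  initial segment, nothing has to be projected away.\<close>

lemma (in Ionescu_Tulcea) distr_lim_restrict:
  "distr PF.lim (PiM {0..<n} M) (\<lambda>\<omega>. restrict \<omega> {0..<n}) = C 0 n (\<lambda>_. undefined)"
proof -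
  have u: "(\<lambda>_. undefined) \<in> space (PiM {0..<0} M)"
    by (simp add: space_PiM)
  have "{0..<n} \<subseteq> {0..<up_to {0..<n}}"
    using up_to_iff_Ico[of "{0..<n}" "up_to {0..<n}"] by simp
  then have up: "up_to {0..<n} = n"
    using up_to_iff_Ico[of "{0..<n}" n] by auto
  show ?thesis
    unfolding distr_lim[OF finite_atLeastLessThan] CI_def up
    using distr_C[OF order_refl u, of n] by simp
qed

text \<open>Image measures keep total mass, so the projection to the empty set of coordinates
  already decides the claim.\<close>

lemma (in Ionescu_Tulcea) prob_space_lim: "prob_space PF.lim"
proof (rule prob_space_distrD)
  show "prob_space (distr PF.lim (PiM {0..<0} M) (\<lambda>\<omega>. restrict \<omega> {0..<0}))"
    unfolding distr_lim_restrict by (rule prob_space_C) (simp add: space_PiM)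
qed (simp add: measurable_cong_sets[OF PF.sets_lim refl] measurable_restrict_subset)

text \<open>The composite \<open>C 0 (Suc n)\<close> is \<open>C 0 n\<close> followed by
  \<open>eP n\<close>, which appends a draw from \<open>P n\<close> as coordinate n. Reading off
  that coordinate leaves the draw, and \<open>C 0 n\<close> is the law of the past under the
  limit.\<close>

lemma (in Ionescu_Tulcea) distr_lim_component:
  "distr PF.lim (M n) (\<lambda>\<omega>. \<omega> n) = PF.lim \<bind> (\<lambda>\<omega>. P n (restrict \<omega> {0..<n}))"
proof -
  let ?u = "\<lambda>_::nat. undefined :: 'a"
  have u: "?u \<in> space (PiM {0..<0} M)"
    by (simp add: space_PiM)
  have comp: "(\<lambda>\<omega>. \<omega> n) \<in> PiM {0..<Suc n} M \<rightarrow>\<^sub>M M n"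
    by (rule measurable_component_singleton) simp
  have restr: "(\<lambda>\<omega>. restrict \<omega> {0..<k}) \<in> PF.lim \<rightarrow>\<^sub>M PiM {0..<k} M" for k
    by (simp add: measurable_cong_sets[OF PF.sets_lim refl] measurable_restrict_subset)
  have setsC: "sets (C 0 n ?u) = sets (PiM {0..<n} M)"
    using sets_C[OF u, of n] by simp
  have neC: "space (C 0 n ?u) \<noteq> {}"
    using prob_space.not_empty[OF prob_space_C[OF u, of n]] .
  have eP: "eP n \<in> C 0 n ?u \<rightarrow>\<^sub>M subprob_algebra (PiM {0..<Suc n} M)"
    using measurable_eP[of n] by (simp add: measurable_cong_sets[OF setsC refl])
  have "distr PF.lim (M n) (\<lambda>\<omega>. \<omega> n) = distr (C 0 (Suc n) ?u) (M n) (\<lambda>\<omega>. \<omega> n)"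
    unfolding distr_lim_restrict[symmetric]
    by (subst distr_distr[OF comp restr]) (simp add: comp_def)
  also have "\<dots> = C 0 n ?u \<bind> (\<lambda>\<omega>. distr (eP n \<omega>) (M n) (\<lambda>\<omega>. \<omega> n))"
    using distr_bind[OF eP neC comp] by simp
  also have "\<dots> = C 0 n ?u \<bind> P n"
  proof (rule bind_cong[OF refl])
    fix \<omega> assume "\<omega> \<in> space (C 0 n ?u)"
    then have \<omega>: "\<omega> \<in> space (PiM {0..<n} M)"
      using sets_eq_imp_space_eq[OF setsC] by simp
    have upd: "fun_upd \<omega> n \<in> P n \<omega> \<rightarrow>\<^sub>M PiM {0..<Suc n} M"
      unfolding measurable_cong_sets[OF sets_P[OF \<omega>] refl] using \<omega>
      by (intro measurable_fun_upd[where J="{0..<n}"]) auto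
    show "distr (eP n \<omega>) (M n) (\<lambda>\<omega>. \<omega> n) = P n \<omega>"
      unfolding eP_def
      by (subst distr_distr[OF comp upd]) (simp add: comp_def distr_id2 sets_P[OF \<omega>])
  qed
  also have "\<dots> = PF.lim \<bind> (\<lambda>\<omega>. P n (restrict \<omega> {0..<n}))"
    unfolding distr_lim_restrict[symmetric] by (rule bind_distr[OF restr P]) simp
  finally show ?thesis .
qed

text \<open>The one-time marginals of the trajectory, written as a Markov recursion that adds the
  latest step. In this form they can be handled by the laws of \<open>bind\<close> without any path
  space.\<close>

primrec state_action_law ::
  "'a measure \<Rightarrow> ('s::metric_space, 'a) kernel \<Rightarrow> ('s, 'a) policy \<Rightarrow> 's measure
    \<Rightarrow> nat \<Rightarrow> ('s \<times> 'a) measure" where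
  "state_action_law A Q \<pi> \<mu> 0 = with_action A \<pi> \<mu>"
| "state_action_law A Q \<pi> \<mu> (Suc n) = state_action_law A Q \<pi> \<mu> n \<bind> (\<lambda>x. with_action A \<pi> (Q x))"

lemma measurable_with_action_kernel:
  assumes "is_kernel A Q" "is_policy A \<pi>"
  shows "(\<lambda>x. with_action A \<pi> (Q x)) \<in> SA A \<rightarrow>\<^sub>M prob_algebra (SA A)"
  using assms(1) with_action_measurable[OF assms(2)] unfolding is_kernel_def
  by (rule measurable_compose)

text \<open>With the initial law as the variable, composing with \<open>return borel\<close> or with
  a kernel yields again a kernel: from start states, or from pairs through their next-state
  law.\<close>

lemma measurable_state_action_law:
  assumes "is_kernel A Q" "is_policy A \<pi>"
  shows "(\<lambda>\<mu>. state_action_law A Q \<pi> \<mu> n) \<in> prob_algebra borel \<rightarrow>\<^sub>M prob_algebra (SA A)"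
proof (induction n)
  case 0
  then show ?case
    using with_action_measurable[OF assms(2)] by simp
next
  case (Suc n)
  show ?case
    using measurable_bind_prob_space[OF Suc measurable_with_action_kernel[OF assms]] by simp
qed

text \<open>The recursion peels off the last step, whereas the Bellman equation peels off the first;
  associativity of \<open>bind\<close> converts one into the other.\<close>

lemma state_action_law_Suc:
  assumes Q: "is_kernel A Q" and \<pi>: "is_policy A \<pi>" and \<mu>: "\<mu> \<in> space (prob_algebra borel)"
  shows "state_action_law A Q \<pi> \<mu> (Suc n) = with_action A \<pi> \<mu> \<bind> (\<lambda>x. state_action_law A Q \<pi> (Q x) n)"
proof (induction n)
  case 0
  then show ?case by simp
next
  case (Suc n)
  have Q': "Q \<in> SA A \<rightarrow>\<^sub>M prob_algebra borel"
    using Q by (simp add: is_kernel_def)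
  show ?case
    unfolding state_action_law.simps(2)[of A Q \<pi> \<mu> "Suc n"] Suc
    by (subst bind_assoc_prob_algebra[OF measurable_space[OF with_action_measurable[OF \<pi>] \<mu>]
          measurable_compose[OF Q' measurable_state_action_law[OF Q \<pi>]]
          measurable_with_action_kernel[OF Q \<pi>]]) simp
qed

lemma with_action_bind:
  assumes \<pi>: "is_policy A \<pi>" and \<mu>: "\<mu> \<in> space (prob_algebra borel)"
  shows "with_action A \<pi> \<mu> = \<mu> \<bind> (\<lambda>s. with_action A \<pi> (return borel s))"
proof (unfold with_action_def[of A \<pi> \<mu>], rule bind_cong[OF refl])
  fix s
  have [measurable]: "\<pi> \<in> borel \<rightarrow>\<^sub>M prob_algebra A"
    using \<pi> by (simp add: is_policy_def)
  have "(\<lambda>s. \<pi> s \<bind> (\<lambda>a. return (SA A) (s, a))) \<in> borel \<rightarrow>\<^sub>M prob_algebra (SA A)"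
    by measurable
  then show "\<pi> s \<bind> (\<lambda>a. return (SA A) (s, a)) = with_action A \<pi> (return borel s)"
    unfolding with_action_def by (subst bind_return[OF measurable_prob_algebraD, where N="SA A"]) auto
qed

text \<open>The value function starts paths at points, the occupancy starts them from a law.
  Disintegrating over the start state connects the two.\<close>

lemma state_action_law_bind:
  assumes Q: "is_kernel A Q" and \<pi>: "is_policy A \<pi>" and \<mu>: "\<mu> \<in> space (prob_algebra borel)"
  shows "state_action_law A Q \<pi> \<mu> n = \<mu> \<bind> (\<lambda>s. state_action_law A Q \<pi> (return borel s) n)"
proof (induction n)
  case 0
  then show ?case
    using with_action_bind[OF \<pi> \<mu>] by simp
next
  case (Suc n)
  show ?case
    unfolding state_action_law.simps(2) Suc
    by (rule bind_assoc_prob_algebra[OF \<mu>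
          measurable_compose[OF measurable_return_prob_space measurable_state_action_law[OF Q \<pi>]]
          measurable_with_action_kernel[OF Q \<pi>]])
qed

section \<open>The path law and its Markov recursion\<close>

lemma trajectory_in_space_prob_algebra:
  assumes "is_kernel A Q" "is_policy A \<pi>" "\<mu> \<in> space (prob_algebra borel)"
  shows "trajectory A Q \<pi> \<mu> \<in> space (prob_algebra (PiM UNIV (\<lambda>_. SA A)))"
proof -
  interpret Ionescu_Tulcea "step_law A Q \<pi> \<mu>" "\<lambda>_. SA A"
    by (rule Ionescu_Tulcea_step_law[OF assms])
  show ?thesis
    using prob_space_lim unfolding trajectory_def by (simp add: space_prob_algebra)
qed

text \<open>The conditional law at time \<open>Suc m\<close> sees the past only through coordinate
  m, so an integral over paths collapses to one over the marginal at time m.\<close>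

lemma distr_trajectory:
  assumes Q: "is_kernel A Q" and \<pi>: "is_policy A \<pi>" and \<mu>: "\<mu> \<in> space (prob_algebra borel)"
  shows "distr (trajectory A Q \<pi> \<mu>) (SA A) (\<lambda>\<omega>. \<omega> n) = state_action_law A Q \<pi> \<mu> n"
proof -
  interpret Ionescu_Tulcea "step_law A Q \<pi> \<mu>" "\<lambda>_. SA A"
    by (rule Ionescu_Tulcea_step_law[OF assms])
  note traj = trajectory_def[of A Q \<pi> \<mu>, symmetric]
  interpret lim: prob_space PF.lim
    by (rule prob_space_lim)
  show ?thesis
  proof (induction n)
    case 0
    have "with_action A \<pi> \<mu> \<in> space (prob_algebra (SA A))"
      using with_action_measurable[OF \<pi>] \<mu> by (rule measurable_space)
    \<comment> \<open>The law at time 0 ignores the (empty) past, and mixing a constant law over a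
      probability measure returns it.\<close>
    then have "PF.lim \<bind> (\<lambda>_. with_action A \<pi> \<mu>) = with_action A \<pi> \<mu>"
      using lim.prob_space_axioms
      by (intro bind_const') (auto simp: space_prob_algebra prob_space_imp_subprob_space)
    then show ?case
      using distr_lim_component[of 0] unfolding traj by (simp add: step_law_def)
  next
    case (Suc m)
    have comp: "(\<lambda>\<omega>. \<omega> m) \<in> PF.lim \<rightarrow>\<^sub>M SA A"
      by (simp add: measurable_cong_sets[OF PF.sets_lim refl] measurable_component_singleton)
    have "distr PF.lim (SA A) (\<lambda>\<omega>. \<omega> (Suc m)) = PF.lim \<bind> (\<lambda>\<omega>. with_action A \<pi> (Q (\<omega> m)))"
      using distr_lim_component[of "Suc m"] by (simp add: step_law_def)
    also have "\<dots> = distr PF.lim (SA A) (\<lambda>\<omega>. \<omega> m) \<bind> (\<lambda>x. with_action A \<pi> (Q x))"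
      by (rule bind_distr[symmetric, OF comp
            measurable_prob_algebraD[OF measurable_with_action_kernel[OF Q \<pi>]] lim.not_empty])
    finally show ?case
      using Suc unfolding traj by simp
  qed
qed

text \<open>The geometric majorant \<gamma>^t B gives absolute summability both pointwise and after
  integration, as the exchange requires. Letting \<open>f\<close> depend on t covers rewards along a
  path as well as expected rewards seen as functions of the start.\<close>

lemma integral_discounted_sum:
  fixes \<gamma> :: real
  assumes \<gamma>: "0 \<le> \<gamma>" "\<gamma> < 1" and M: "M \<in> space (prob_algebra N)"
    and f: "\<And>t. f t \<in> borel_measurable N" and B: "\<And>t x. x \<in> space N \<Longrightarrow> \<bar>f t x\<bar> \<le> B"
  shows "(\<integral>x. (\<Sum>t. \<gamma> ^ t * f t x) \<partial>M) = (\<Sum>t. \<gamma> ^ t * (\<integral>x. f t x \<partial>M))"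
proof -
  have M': "sets M = sets N"
    using M by (simp add: space_prob_algebra)
  have sm: "summable (\<lambda>t. \<gamma> ^ t * B)"
    using \<gamma> by (intro summable_mult2 summable_geometric) simp
  have le: "norm (norm (\<gamma> ^ t * f t x)) \<le> \<gamma> ^ t * B" if "x \<in> space N" for t x
    using B[OF that, of t] \<gamma> by (simp add: abs_mult mult_left_mono)
  have int: "integrable M (\<lambda>x. \<gamma> ^ t * f t x)" for t
    using integrable_prob_algebra_bounded[OF M f B] by simp
  have "(\<integral>x. (\<Sum>t. \<gamma> ^ t * f t x) \<partial>M) = (\<Sum>t. \<integral>x. \<gamma> ^ t * f t x \<partial>M)"
  proof (rule integral_suminf[OF int])
    show "AE x in M. summable (\<lambda>t. norm (\<gamma> ^ t * f t x))"
      using summable_comparison_test'[OF sm le] sets_eq_imp_space_eq[OF M'] by (intro AE_I2) simp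
    have "norm (\<integral>x. norm (\<gamma> ^ t * f t x) \<partial>M) \<le> \<gamma> ^ t * B" for t
      unfolding real_norm_def
    proof (rule abs_integral_prob_algebra_le[OF M])
      show "(\<lambda>x. \<bar>\<gamma> ^ t * f t x\<bar>) \<in> borel_measurable N"
        using f[of t] by measurable
    qed (use le in simp)
    then show "summable (\<lambda>t. \<integral>x. norm (\<gamma> ^ t * f t x) \<partial>M)"
      by (intro summable_comparison_test'[OF sm])
  qed
  then show ?thesis
    by simp
qed

lemma with_action_in_space:
  assumes "is_policy A \<pi>" "\<mu> \<in> space (prob_algebra borel)"
  shows "with_action A \<pi> \<mu> \<in> space (prob_algebra (SA A))"
  using with_action_measurable[OF assms(1)] assms(2) by (rule measurable_space)

lemma state_action_law_in_space:
  assumes "is_kernel A Q" "is_policy A \<pi>" "\<mu> \<in> space (prob_algebra borel)"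
  shows "state_action_law A Q \<pi> \<mu> t \<in> space (prob_algebra (SA A))"
  using measurable_state_action_law[OF assms(1,2)] assms(3) by (rule measurable_space)

lemma integral_discounted_trajectory:
  fixes \<gamma> :: real
  assumes \<gamma>: "0 \<le> \<gamma>" "\<gamma> < 1"
    and law: "is_kernel A Q" "is_policy A \<pi>" "\<mu> \<in> space (prob_algebra borel)"
    and f: "f \<in> borel_measurable (SA A)" and B: "\<And>x. x \<in> space (SA A) \<Longrightarrow> \<bar>f x\<bar> \<le> B"
  shows "(\<integral>\<omega>. (\<Sum>t. \<gamma> ^ t * f (\<omega> t)) \<partial>trajectory A Q \<pi> \<mu>)
    = (\<Sum>t. \<gamma> ^ t * (\<integral>x. f x \<partial>state_action_law A Q \<pi> \<mu> t))"
proof -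
  note traj = trajectory_in_space_prob_algebra[OF law]
  have comp: "(\<lambda>\<omega>. \<omega> t) \<in> PiM UNIV (\<lambda>_. SA A) \<rightarrow>\<^sub>M SA A" for t :: nat
    by (rule measurable_component_singleton) simp
  have "(\<integral>\<omega>. (\<Sum>t. \<gamma> ^ t * f (\<omega> t)) \<partial>trajectory A Q \<pi> \<mu>)
      = (\<Sum>t. \<gamma> ^ t * (\<integral>\<omega>. f (\<omega> t) \<partial>trajectory A Q \<pi> \<mu>))"
    by (intro integral_discounted_sum[OF \<gamma> traj, where B=B] measurable_compose[OF comp f] B
        measurable_space[OF comp])
  moreover have "(\<integral>\<omega>. f (\<omega> t) \<partial>trajectory A Q \<pi> \<mu>) = (\<integral>x. f x \<partial>state_action_law A Q \<pi> \<mu> t)" for t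
    unfolding distr_trajectory[OF law, symmetric]
    using comp traj f
    by (intro integral_distr[symmetric]) (simp_all add: space_prob_algebra cong: measurable_cong_sets)
  ultimately show ?thesis
    by simp
qed

subsection \<open>Discounted values\<close>

text \<open>The bound is restricted to \<open>space (SA A)\<close> because the actions in
  \<open>A\<close> need not exhaust their type.\<close>

locale discounted_mdp =
  fixes A :: "'a measure" and \<gamma> :: real and r :: "'s::metric_space \<times> 'a \<Rightarrow> real" and R :: real
  assumes discount: "0 < \<gamma>" "\<gamma> < 1"
    and measurable_reward: "r \<in> borel_measurable (SA A)"
    and reward_bound: "\<And>x. x \<in> space (SA A) \<Longrightarrow> \<bar>r x\<bar> \<le> R"
begin

lemma value_fun_eq_suminf:
  assumes Q: "is_kernel A Q" and \<pi>: "is_policy A \<pi>"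
  shows "value_fun A \<gamma> r Q \<pi> s
    = (\<Sum>t. \<gamma> ^ t * (\<integral>x. r x \<partial>state_action_law A Q \<pi> (return borel s) t))"
  unfolding value_fun_def using discount reward_bound
  by (intro integral_discounted_trajectory Q \<pi> measurable_reward)
    (auto simp: space_prob_algebra prob_space_return)

lemma abs_integral_reward_le:
  assumes "is_kernel A Q" "is_policy A \<pi>" "\<mu> \<in> space (prob_algebra borel)"
  shows "\<bar>\<integral>x. r x \<partial>state_action_law A Q \<pi> \<mu> t\<bar> \<le> R"
  by (rule abs_integral_prob_algebra_le[OF state_action_law_in_space[OF assms] measurable_reward reward_bound])

lemma summable_rewards:
  assumes "is_kernel A Q" "is_policy A \<pi>" "\<mu> \<in> space (prob_algebra borel)"
  shows "summable (\<lambda>t. \<gamma> ^ t * (\<integral>x. r x \<partial>state_action_law A Q \<pi> \<mu> t))"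
proof (rule summable_comparison_test')
  show "summable (\<lambda>t. \<gamma> ^ t * R)"
    using discount by (intro summable_mult2 summable_geometric) simp
  show "norm (\<gamma> ^ t * (\<integral>x. r x \<partial>state_action_law A Q \<pi> \<mu> t)) \<le> \<gamma> ^ t * R" for t
    using abs_integral_reward_le[OF assms, of t] discount by (simp add: abs_mult mult_left_mono)
qed

lemma measurable_value_fun:
  assumes Q: "is_kernel A Q" and \<pi>: "is_policy A \<pi>"
  shows "value_fun A \<gamma> r Q \<pi> \<in> borel_measurable borel"
proof -
  have "(\<lambda>s. \<Sum>t. \<gamma> ^ t * (\<integral>x. r x \<partial>state_action_law A Q \<pi> (return borel s) t)) \<in> borel_measurable borel"
    by (intro borel_measurable_suminf borel_measurable_times borel_measurable_const
        measurable_integral_kernel[OF measurable_compose[OF measurable_return_prob_space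
            measurable_state_action_law[OF Q \<pi>]] measurable_reward])
  then show ?thesis
    unfolding value_fun_eq_suminf[OF Q \<pi>, abs_def] .
qed

lemma abs_value_fun_le:
  assumes Q: "is_kernel A Q" and \<pi>: "is_policy A \<pi>"
  shows "\<bar>value_fun A \<gamma> r Q \<pi> s\<bar> \<le> R / (1 - \<gamma>)"
proof -
  have s: "return borel s \<in> space (prob_algebra borel)"
    by (simp add: space_prob_algebra prob_space_return)
  have sums: "(\<lambda>t. \<gamma> ^ t * R) sums (1 / (1 - \<gamma>) * R)"
    using discount by (intro sums_mult2 geometric_sums) simp
  have "norm (\<Sum>t. \<gamma> ^ t * (\<integral>x. r x \<partial>state_action_law A Q \<pi> (return borel s) t)) \<le> (\<Sum>t. \<gamma> ^ t * R)"
    using abs_integral_reward_le[OF Q \<pi> s] discount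
    by (intro norm_suminf_le sums_summable[OF sums]) (simp add: abs_mult mult_left_mono)
  then show ?thesis
    unfolding value_fun_eq_suminf[OF Q \<pi>] using sums_unique[OF sums] by simp
qed

lemma policy_value_eq_suminf:
  assumes Q: "is_kernel A Q" and \<pi>: "is_policy A \<pi>" and \<mu>: "\<mu> \<in> space (prob_algebra borel)"
  shows "policy_value A \<gamma> r \<mu> Q \<pi> = (\<Sum>t. \<gamma> ^ t * (\<integral>x. r x \<partial>state_action_law A Q \<pi> \<mu> t))"
proof -
  note kernel = measurable_compose[OF measurable_return_prob_space measurable_state_action_law[OF Q \<pi>]]
  have "policy_value A \<gamma> r \<mu> Q \<pi>
      = (\<Sum>t. \<gamma> ^ t * (\<integral>s. \<integral>x. r x \<partial>state_action_law A Q \<pi> (return borel s) t \<partial>\<mu>))"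
    unfolding policy_value_def value_fun_eq_suminf[OF Q \<pi>] using discount
    by (intro integral_discounted_sum[OF _ _ \<mu>, where B=R] measurable_integral_kernel[OF kernel measurable_reward]
        abs_integral_reward_le[OF Q \<pi>])
      (auto simp: space_prob_algebra prob_space_return)
  moreover have "(\<integral>s. \<integral>x. r x \<partial>state_action_law A Q \<pi> (return borel s) t \<partial>\<mu>)
      = (\<integral>x. r x \<partial>state_action_law A Q \<pi> \<mu> t)" for t
    unfolding state_action_law_bind[OF Q \<pi> \<mu>, of t]
    by (rule integral_bind_prob_algebra[OF \<mu> kernel measurable_reward reward_bound, symmetric])
  ultimately show ?thesis
    by simp
qed

text \<open>Taking \<open>P x\<close> as initial law makes \<open>policy_value\<close> the one-step
  expectation of the value function of \<open>Q\<close>, that is, P V at x. With \<open>P\<close>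
  and \<open>Q\<close> independent of each other, P V and Q V become instances of one
  expression.\<close>

lemma measurable_policy_value:
  assumes Q: "is_kernel A Q" and \<pi>: "is_policy A \<pi>" and P: "is_kernel A P"
  shows "(\<lambda>x. policy_value A \<gamma> r (P x) Q \<pi>) \<in> borel_measurable (SA A)"
  unfolding policy_value_def using P
  by (intro measurable_integral_kernel[OF _ measurable_value_fun[OF Q \<pi>]]) (simp add: is_kernel_def)

lemma kernel_in_space:
  assumes "is_kernel A P" "x \<in> space (SA A)"
  shows "P x \<in> space (prob_algebra borel)"
  using assms unfolding is_kernel_def by (rule measurable_space)

lemma abs_policy_value_le:
  assumes Q: "is_kernel A Q" and \<pi>: "is_policy A \<pi>" and \<mu>: "\<mu> \<in> space (prob_algebra borel)"
  shows "\<bar>policy_value A \<gamma> r \<mu> Q \<pi>\<bar> \<le> R / (1 - \<gamma>)"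
  unfolding policy_value_def
  by (intro abs_integral_prob_algebra_le[OF \<mu>] measurable_value_fun abs_value_fun_le Q \<pi>)

text \<open>After the first pair x the process restarts with initial law \<open>Q x\<close>, and its
  discounted series is the original one shifted by one index. An arbitrary \<mu> is allowed so that
  \<mu> can be a next-state law of a different kernel.\<close>

lemma policy_value_bellman:
  assumes Q: "is_kernel A Q" and \<pi>: "is_policy A \<pi>" and \<mu>: "\<mu> \<in> space (prob_algebra borel)"
  shows "policy_value A \<gamma> r \<mu> Q \<pi> = (\<integral>x. r x + \<gamma> * policy_value A \<gamma> r (Q x) Q \<pi> \<partial>with_action A \<pi> \<mu>)"
proof -
  have wa: "with_action A \<pi> \<mu> \<in> space (prob_algebra (SA A))"
    by (rule with_action_in_space[OF \<pi> \<mu>])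
  have Q': "Q \<in> SA A \<rightarrow>\<^sub>M prob_algebra borel"
    using Q by (simp add: is_kernel_def)
  note kernel = measurable_compose[OF Q' measurable_state_action_law[OF Q \<pi>]]
  let ?c = "\<lambda>t. \<integral>x. r x \<partial>state_action_law A Q \<pi> \<mu> t"
  have shift: "(\<integral>x. \<integral>y. r y \<partial>state_action_law A Q \<pi> (Q x) t \<partial>with_action A \<pi> \<mu>) = ?c (Suc t)" for t
    unfolding state_action_law_Suc[OF Q \<pi> \<mu>]
    by (rule integral_bind_prob_algebra[OF wa kernel measurable_reward reward_bound, symmetric])
  have space_eq: "space (with_action A \<pi> \<mu>) = space (SA A)"
    using wa by (intro sets_eq_imp_space_eq) (simp add: space_prob_algebra)
  have "(\<integral>x. policy_value A \<gamma> r (Q x) Q \<pi> \<partial>with_action A \<pi> \<mu>)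
      = (\<integral>x. (\<Sum>t. \<gamma> ^ t * (\<integral>y. r y \<partial>state_action_law A Q \<pi> (Q x) t)) \<partial>with_action A \<pi> \<mu>)"
    using policy_value_eq_suminf[OF Q \<pi> kernel_in_space[OF Q]] space_eq
    by (intro Bochner_Integration.integral_cong) auto
  also have "\<dots> = (\<Sum>t. \<gamma> ^ t * (\<integral>x. \<integral>y. r y \<partial>state_action_law A Q \<pi> (Q x) t \<partial>with_action A \<pi> \<mu>))"
    using discount
    by (intro integral_discounted_sum[OF _ _ wa, where B=R] measurable_integral_kernel[OF kernel measurable_reward]
        abs_integral_reward_le[OF Q \<pi>] kernel_in_space[OF Q]) auto
  also have "\<dots> = (\<Sum>t. \<gamma> ^ t * ?c (Suc t))"
    by (simp only: shift)
  finally have eq: "(\<integral>x. policy_value A \<gamma> r (Q x) Q \<pi> \<partial>with_action A \<pi> \<mu>) = (\<Sum>t. \<gamma> ^ t * ?c (Suc t))" .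
  \<comment> \<open>The shifted reward series carries one extra \<gamma>; since \<gamma> is nonzero
    it can be cancelled, which gives summability of the series without it.\<close>
  have sm: "summable (\<lambda>t. \<gamma> * (\<gamma> ^ t * ?c (Suc t)))"
    using summable_rewards[OF Q \<pi> \<mu>, THEN summable_Suc_iff[THEN iffD2]] by (simp add: mult.assoc)
  have "\<gamma> * (\<integral>x. policy_value A \<gamma> r (Q x) Q \<pi> \<partial>with_action A \<pi> \<mu>) = (\<Sum>t. \<gamma> ^ Suc t * ?c (Suc t))"
    unfolding eq using summable_mult_D[OF sm] discount
    by (subst suminf_mult[symmetric]) (simp_all add: mult.assoc)
  then have "policy_value A \<gamma> r \<mu> Q \<pi>
      = (\<integral>x. r x \<partial>with_action A \<pi> \<mu>) + \<gamma> * (\<integral>x. policy_value A \<gamma> r (Q x) Q \<pi> \<partial>with_action A \<pi> \<mu>)"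
    unfolding policy_value_eq_suminf[OF Q \<pi> \<mu>] using suminf_split_head[OF summable_rewards[OF Q \<pi> \<mu>]] by simp
  also have "\<dots> = (\<integral>x. r x + \<gamma> * policy_value A \<gamma> r (Q x) Q \<pi> \<partial>with_action A \<pi> \<mu>)"
    using integrable_prob_algebra_bounded[OF wa measurable_reward reward_bound]
      integrable_prob_algebra_bounded[OF wa measurable_policy_value[OF Q \<pi> Q]
        abs_policy_value_le[OF Q \<pi> kernel_in_space[OF Q]]]
    by simp
  finally show ?thesis .
qed

text \<open>Below, \<open>h\<close> is P V, \<open>g\<close> is Q V, and \<open>b t\<close> is the
  hybrid value at switching time t. Passing from \<open>b t\<close> to \<open>b (Suc t)\<close>
  applies the Bellman equation of \<open>Q\<close> with initial law \<open>P x\<close>.\<close>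

lemma simulation_identity:
  assumes P: "is_kernel A P" and Q: "is_kernel A Q" and \<pi>: "is_policy A \<pi>"
    and \<mu>: "\<mu> \<in> space (prob_algebra borel)"
  shows "(\<lambda>t. \<gamma> * (\<gamma> ^ t * (\<integral>x. critic_gap P Q (\<lambda>_. value_fun A \<gamma> r Q \<pi>) x \<partial>state_action_law A P \<pi> \<mu> t)))
    sums (policy_value A \<gamma> r \<mu> P \<pi> - policy_value A \<gamma> r \<mu> Q \<pi>)"
proof -
  let ?m = "state_action_law A P \<pi> \<mu>"
  define h where "h x = policy_value A \<gamma> r (P x) Q \<pi>" for x
  define g where "g x = policy_value A \<gamma> r (Q x) Q \<pi>" for x
  define b where "b t = (\<integral>x. r x + \<gamma> * g x \<partial>?m t)" for t
  have gap: "critic_gap P Q (\<lambda>_. value_fun A \<gamma> r Q \<pi>) = (\<lambda>x. h x - g x)"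
    unfolding critic_gap_def h_def g_def policy_value_def by simp
  note m = state_action_law_in_space[OF P \<pi> \<mu>]
  have h: "h \<in> borel_measurable (SA A)" and g: "g \<in> borel_measurable (SA A)"
    unfolding h_def g_def by (intro measurable_policy_value P Q \<pi>)+
  have hB: "\<bar>h x\<bar> \<le> R / (1 - \<gamma>)" and gB: "\<bar>g x\<bar> \<le> R / (1 - \<gamma>)" if "x \<in> space (SA A)" for x
    unfolding h_def g_def by (intro abs_policy_value_le kernel_in_space P Q \<pi> that)+
  have int: "integrable (?m t) r" "integrable (?m t) h" "integrable (?m t) g" for t
    using integrable_prob_algebra_bounded[OF m] measurable_reward reward_bound h hB g gB by blast+
  have rg: "(\<lambda>x. r x + \<gamma> * g x) \<in> borel_measurable (SA A)"
    using measurable_reward g by measurable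
  have rgB: "\<bar>r x + \<gamma> * g x\<bar> \<le> R + \<gamma> * (R / (1 - \<gamma>))" if "x \<in> space (SA A)" for x
    using reward_bound[OF that] mult_left_mono[OF gB[OF that], of \<gamma>] discount
    by (intro abs_triangle_ineq[THEN order_trans] add_mono) (simp_all add: abs_mult)
  have b0: "b 0 = policy_value A \<gamma> r \<mu> Q \<pi>"
    unfolding b_def g_def using policy_value_bellman[OF Q \<pi> \<mu>] by simp
  have bSuc: "b (Suc t) = (\<integral>x. h x \<partial>?m t)" for t
  proof -
    have "b (Suc t) = (\<integral>x. \<integral>y. r y + \<gamma> * g y \<partial>with_action A \<pi> (P x) \<partial>?m t)"
      unfolding b_def state_action_law.simps(2)
      by (rule integral_bind_prob_algebra[OF m measurable_with_action_kernel[OF P \<pi>] rg rgB])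
    also have "\<dots> = (\<integral>x. h x \<partial>?m t)"
    proof (rule Bochner_Integration.integral_cong[OF refl])
      fix x assume "x \<in> space (?m t)"
      then have "x \<in> space (SA A)"
        using m[of t] sets_eq_imp_space_eq[of "?m t" "SA A"] by (simp add: space_prob_algebra)
      then show "(\<integral>y. r y + \<gamma> * g y \<partial>with_action A \<pi> (P x)) = h x"
        unfolding g_def h_def using policy_value_bellman[OF Q \<pi> kernel_in_space[OF P]] by simp
    qed
    finally show ?thesis .
  qed
  \<comment> \<open>The boundary term of the telescope: \<open>b\<close> is bounded uniformly in t,
    so discounting kills it.\<close>
  have "(\<lambda>t. \<gamma> ^ t * b t) \<longlonglongrightarrow> 0"
  proof (rule Lim_null_comparison)
    show "\<forall>\<^sub>F t in sequentially. norm (\<gamma> ^ t * b t) \<le> \<gamma> ^ t * (R + \<gamma> * (R / (1 - \<gamma>)))"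
      unfolding b_def using abs_integral_prob_algebra_le[OF m rg rgB] discount
      by (intro always_eventually) (auto simp: abs_mult intro!: mult_left_mono)
    show "(\<lambda>t. \<gamma> ^ t * (R + \<gamma> * (R / (1 - \<gamma>)))) \<longlonglongrightarrow> 0"
      using discount by (intro tendsto_mult_left_zero LIMSEQ_power_zero) simp
  qed
  from telescope_sums'[OF this]
  have "(\<lambda>t. \<gamma> ^ t * b t - \<gamma> ^ Suc t * b (Suc t)) sums policy_value A \<gamma> r \<mu> Q \<pi>"
    by (simp add: b0)
  moreover have "(\<lambda>t. \<gamma> ^ t * (\<integral>x. r x \<partial>?m t)) sums policy_value A \<gamma> r \<mu> P \<pi>"
    unfolding policy_value_eq_suminf[OF P \<pi> \<mu>] by (rule summable_sums[OF summable_rewards[OF P \<pi> \<mu>]])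
  ultimately have "(\<lambda>t. \<gamma> ^ t * (\<integral>x. r x \<partial>?m t) - (\<gamma> ^ t * b t - \<gamma> ^ Suc t * b (Suc t)))
      sums (policy_value A \<gamma> r \<mu> P \<pi> - policy_value A \<gamma> r \<mu> Q \<pi>)"
    by (intro sums_diff)
  \<comment> \<open>The rewards cancel. Rewriting \<open>b (Suc t)\<close> as the integral of
    \<open>h\<close> before unfolding \<open>b t\<close> puts both integrals under the law at time
    t.\<close>
  moreover have "\<gamma> ^ t * (\<integral>x. r x \<partial>?m t) - (\<gamma> ^ t * b t - \<gamma> ^ Suc t * b (Suc t))
      = \<gamma> * (\<gamma> ^ t * (\<integral>x. h x - g x \<partial>?m t))" for t
    unfolding bSuc unfolding b_def using int[of t] by (simp add: algebra_simps)
  ultimately show ?thesis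
    unfolding gap by simp
qed

end

subsection \<open>Coverage and critics\<close>

lemma occupancy_eq_suminf:
  assumes \<gamma>: "0 \<le> \<gamma>" "\<gamma> < 1"
    and law: "is_kernel A Q" "is_policy A \<pi>" "\<mu> \<in> space (prob_algebra borel)"
    and B: "B \<in> sets (SA A)"
  shows "occupancy A \<gamma> \<mu> Q \<pi> B = (\<Sum>t. \<gamma> ^ t * measure (state_action_law A Q \<pi> \<mu> t) B)"
proof -
  have "B \<in> sets (state_action_law A Q \<pi> \<mu> t)" for t
    using state_action_law_in_space[OF law, of t] B by (simp add: space_prob_algebra)
  then have "B \<inter> space (state_action_law A Q \<pi> \<mu> t) = B" for t
    by (meson Int_absorb2 sets.sets_into_space)
  moreover have "occupancy A \<gamma> \<mu> Q \<pi> B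
      = (\<Sum>t. \<gamma> ^ t * (\<integral>x. indicator B x \<partial>state_action_law A Q \<pi> \<mu> t))"
    unfolding occupancy_def using B
    by (intro integral_discounted_trajectory[OF \<gamma> law, where B=1]) (auto simp: indicator_def)
  ultimately show ?thesis
    by simp
qed

text \<open>Coverage is moved to \<open>ennreal\<close>, extended there from sets to functions, and
  moved back; boundedness of \<open>u\<close> makes all the series and integrals finite.\<close>

lemma discounted_integral_le_coverage:
  assumes \<gamma>: "0 \<le> \<gamma>" "\<gamma> < 1"
    and law: "is_kernel A Q" "is_policy A \<pi>" "\<mu> \<in> space (prob_algebra borel)"
    and d: "d \<in> space (prob_algebra (SA A))"
    and coverage: "\<And>B. B \<in> sets (SA A) \<Longrightarrow> occupancy A \<gamma> \<mu> Q \<pi> B \<le> \<kappa> * measure d B"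
    and u: "u \<in> borel_measurable (SA A)" "\<And>x. x \<in> space (SA A) \<Longrightarrow> 0 \<le> u x"
      "\<And>x. x \<in> space (SA A) \<Longrightarrow> u x \<le> C"
  shows "(\<Sum>t. \<gamma> ^ t * (\<integral>x. u x \<partial>state_action_law A Q \<pi> \<mu> t)) \<le> \<kappa> * (\<integral>x. u x \<partial>d)"
    and "0 \<le> \<kappa>"
proof -
  let ?m = "state_action_law A Q \<pi> \<mu>"
  note m = state_action_law_in_space[OF law]
  have nonneg: "0 \<le> \<gamma> ^ t" for t
    using \<gamma> by simp
  have pm: "prob_space (?m t)" for t
    using m[of t] by (simp add: space_prob_algebra)
  interpret d: prob_space d
    using d by (simp add: space_prob_algebra)
  have space_d: "space d = space (SA A)"
    using d sets_eq_imp_space_eq[of d "SA A"] by (simp add: space_prob_algebra)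
  have bounded_summable: "summable (\<lambda>t. \<gamma> ^ t * c t)" if "\<And>t. \<bar>c t\<bar> \<le> C'" for c :: "nat \<Rightarrow> real" and C'
  proof (rule summable_comparison_test')
    show "summable (\<lambda>t. \<gamma> ^ t * C')"
      using \<gamma> by (intro summable_mult2 summable_geometric) simp
    show "norm (\<gamma> ^ t * c t) \<le> \<gamma> ^ t * C'" for t
      using that[of t] nonneg[of t] by (simp add: abs_mult mult_left_mono)
  qed
  \<comment> \<open>The sign of \<kappa> comes from coverage of the whole space, where the occupancy
    is nonnegative and \<open>d\<close> has mass 1.\<close>
  have "0 \<le> occupancy A \<gamma> \<mu> Q \<pi> (space (SA A))"
    unfolding occupancy_eq_suminf[OF \<gamma> law sets.top]
    using nonneg prob_space.prob_le_1[OF pm]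
    by (intro suminf_nonneg bounded_summable[of _ 1]) auto
  also have "\<dots> \<le> \<kappa> * measure d (space (SA A))"
    by (rule coverage) simp
  finally show \<kappa>: "0 \<le> \<kappa>"
    using d.prob_space space_d by simp
  have uC: "\<bar>u x\<bar> \<le> C" if "x \<in> space (SA A)" for x
    using u(2,3)[OF that] by simp
  have nn: "(\<integral>\<^sup>+x. ennreal (u x) \<partial>M) = ennreal (\<integral>x. u x \<partial>M)" "0 \<le> (\<integral>x. u x \<partial>M)"
    if M: "M \<in> space (prob_algebra (SA A))" for M
  proof -
    have "space M = space (SA A)"
      using M sets_eq_imp_space_eq[of M "SA A"] by (simp add: space_prob_algebra)
    then have "AE x in M. 0 \<le> u x"
      using u(2) by (intro AE_I2) simp
    then show "(\<integral>\<^sup>+x. ennreal (u x) \<partial>M) = ennreal (\<integral>x. u x \<partial>M)" "0 \<le> (\<integral>x. u x \<partial>M)"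
      using integrable_prob_algebra_bounded[OF M u(1) uC]
      by (simp_all add: nn_integral_eq_integral integral_nonneg_AE)
  qed
  have "(\<Sum>t. ennreal (\<gamma> ^ t) * emeasure (?m t) B) \<le> ennreal \<kappa> * emeasure d B" if B: "B \<in> sets (SA A)" for B
  proof -
    have em: "emeasure (?m t) B = ennreal (measure (?m t) B)" for t
      by (rule finite_measure.emeasure_eq_measure[OF prob_space.finite_measure[OF pm]])
    have "(\<Sum>t. ennreal (\<gamma> ^ t) * emeasure (?m t) B) = (\<Sum>t. ennreal (\<gamma> ^ t * measure (?m t) B))"
      using nonneg by (simp add: em ennreal_mult)
    also have "\<dots> = ennreal (\<Sum>t. \<gamma> ^ t * measure (?m t) B)"
      using nonneg prob_space.prob_le_1[OF pm]
      by (intro suminf_ennreal2 bounded_summable[of _ 1]) auto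
    also have "\<dots> \<le> ennreal (\<kappa> * measure d B)"
      unfolding occupancy_eq_suminf[OF \<gamma> law B, symmetric] by (intro ennreal_leI coverage B)
    finally show ?thesis
      using \<kappa> by (simp add: ennreal_mult d.emeasure_eq_measure)
  qed
  moreover have "sets (?m t) = sets d" "sets d = sets (SA A)" for t
    using m[of t] d by (simp_all add: space_prob_algebra)
  ultimately have "(\<Sum>t. ennreal (\<gamma> ^ t) * (\<integral>\<^sup>+x. ennreal (u x) \<partial>?m t)) \<le> ennreal \<kappa> * (\<integral>\<^sup>+x. ennreal (u x) \<partial>d)"
    using u(1) by (intro suminf_nn_integral_le) (auto cong: measurable_cong_sets)
  also have "(\<Sum>t. ennreal (\<gamma> ^ t) * (\<integral>\<^sup>+x. ennreal (u x) \<partial>?m t)) = ennreal (\<Sum>t. \<gamma> ^ t * (\<integral>x. u x \<partial>?m t))"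
    using nonneg nn[OF m] abs_integral_prob_algebra_le[OF m u(1) uC]
    by (subst suminf_ennreal2[symmetric]) (auto simp: ennreal_mult intro!: bounded_summable)
  finally show "(\<Sum>t. \<gamma> ^ t * (\<integral>x. u x \<partial>?m t)) \<le> \<kappa> * (\<integral>x. u x \<partial>d)"
    using \<kappa> nn[OF d] by (simp add: ennreal_mult[symmetric])
qed

section \<open>Critics built from value functions\<close>

lemma abs_critic_gap_le_sup_gap:
  assumes V: "V \<in> borel_measurable borel" "\<And>s. \<bar>V s\<bar> \<le> C" "L-lipschitz_on UNIV V" and L: "0 < L"
    and Px: "P x \<in> space (prob_algebra borel)" and Qx: "Q x \<in> space (prob_algebra borel)"
  shows "ereal (\<bar>critic_gap P Q (\<lambda>_. V) x\<bar> / L) \<le> sup_gap P Q lip_critics x"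
proof -
  \<comment> \<open>The sign \<open>c\<close> treats V and -V together; both are needed because
    \<open>sup_gap\<close> takes no absolute value.\<close>
  have lip: "1-lipschitz_on UNIV (\<lambda>s. c * V s / L)" if "\<bar>c\<bar> = 1" for c :: real
  proof (rule lipschitz_onI)
    fix s t
    have "c * V s / L - c * V t / L = c * (V s - V t) / L"
      by (simp add: algebra_simps diff_divide_distrib)
    then have "dist (c * V s / L) (c * V t / L) = dist (V s) (V t) / L"
      using that L by (simp add: dist_real_def abs_mult)
    also have "\<dots> \<le> 1 * dist s t"
      using lipschitz_onD[OF V(3), of s t] L by (simp add: field_simps)
    finally show "dist (c * V s / L) (c * V t / L) \<le> 1 * dist s t" .
  qed simp
  have int: "integrable M V" if "M \<in> space (prob_algebra borel)" for M
    using integrable_prob_algebra_bounded[OF that V(1,2)] .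
  have "ereal (c * critic_gap P Q (\<lambda>_. V) x / L) \<le> sup_gap P Q lip_critics x" if c: "\<bar>c\<bar> = 1" for c
  proof -
    \<comment> \<open>The critic ignores the pair x. Boundedness of \<open>V\<close> supplies the
      two integrability conditions that \<open>sup_gap\<close> imposes.\<close>
    have "(\<lambda>_ s. c * V s / L) \<in> {D \<in> lip_critics. integrable (P x) (D x) \<and> integrable (Q x) (D x)}"
      using lip[OF c] int[OF Px] int[OF Qx] by (simp add: lip_critics_def)
    then have "ereal (critic_gap P Q (\<lambda>_ s. c * V s / L) x) \<le> sup_gap P Q lip_critics x"
      unfolding sup_gap_def by (rule SUP_upper)
    then show ?thesis
      by (simp add: critic_gap_def right_diff_distrib diff_divide_distrib)
  qed
  from this[of 1] this[of "-1"] show ?thesis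
    by (simp add: abs_if)
qed

text \<open>Nonnegative integrals of nonmeasurable functions are lower integrals, so \<open>f\<close> need not be measurable.\<close>

lemma expect_ge_integral:
  assumes u: "integrable M u" "\<And>x. x \<in> space M \<Longrightarrow> 0 \<le> u x"
    and le: "\<And>x. x \<in> space M \<Longrightarrow> ereal (u x) \<le> f x"
  shows "ereal (\<integral>x. u x \<partial>M) \<le> expect M f"
proof -
  \<comment> \<open>Since \<open>f\<close> dominates a nonnegative function, its negative part
    vanishes and \<open>expect\<close> reduces to its first term.\<close>
  have "(\<integral>\<^sup>+x. e2ennreal (- f x) \<partial>M) = (\<integral>\<^sup>+x. 0 \<partial>M)"
  proof (rule nn_integral_cong)
    fix x assume "x \<in> space M"
    then have "0 \<le> f x"
      using u(2) le by (metis ereal_less_eq(5) order_trans)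
    then show "e2ennreal (- f x) = 0"
      by (simp add: e2ennreal_neg)
  qed
  moreover have "ennreal (\<integral>x. u x \<partial>M) = (\<integral>\<^sup>+x. ennreal (u x) \<partial>M)"
    using u by (intro nn_integral_eq_integral[symmetric]) auto
  moreover have "\<dots> \<le> (\<integral>\<^sup>+x. e2ennreal (f x) \<partial>M)"
    using e2ennreal_mono[OF le] by (intro nn_integral_mono) simp
  ultimately have "enn2ereal (ennreal (\<integral>x. u x \<partial>M)) \<le> expect M f"
    by (simp add: expect_def less_eq_ennreal.rep_eq zero_ennreal.rep_eq)
  then show ?thesis
    using u(2) by (simp add: integral_nonneg)
qed

text \<open>The two estimates meet at the function |u|: coverage carries its discounted integral
  over to \<open>d\<close>, and there the sup gap dominates |u| / L.\<close>

lemma (in discounted_mdp) abs_policy_value_diff_le: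
  assumes P: "is_kernel A P" and Q: "is_kernel A Q" and \<pi>: "is_policy A \<pi>"
    and \<mu>: "\<mu> \<in> space (prob_algebra borel)" and d: "d \<in> space (prob_algebra (SA A))"
    and coverage: "\<And>B. B \<in> sets (SA A) \<Longrightarrow> occupancy A \<gamma> \<mu> P \<pi> B \<le> \<kappa> * measure d B"
    and lipschitz: "L-lipschitz_on UNIV (value_fun A \<gamma> r Q \<pi>)"
    and gap: "expect d (sup_gap P Q lip_critics) \<le> ereal e"
  shows "\<bar>policy_value A \<gamma> r \<mu> P \<pi> - policy_value A \<gamma> r \<mu> Q \<pi>\<bar> \<le> \<gamma> * L * \<kappa> * e"
proof -
  let ?V = "value_fun A \<gamma> r Q \<pi>" and ?m = "state_action_law A P \<pi> \<mu>"
  define u where "u x = critic_gap P Q (\<lambda>_. ?V) x" for x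
  have u_eq: "u x = policy_value A \<gamma> r (P x) Q \<pi> - policy_value A \<gamma> r (Q x) Q \<pi>" for x
    unfolding u_def critic_gap_def policy_value_def ..
  have u: "u \<in> borel_measurable (SA A)"
    unfolding u_eq[abs_def] by (intro borel_measurable_diff measurable_policy_value P Q \<pi>)
  define C where "C = 2 * (R / (1 - \<gamma>))"
  have uB: "\<bar>u x\<bar> \<le> C" if "x \<in> space (SA A)" for x
    unfolding u_eq C_def using abs_policy_value_le[OF Q \<pi> kernel_in_space[OF P that]]
      abs_policy_value_le[OF Q \<pi> kernel_in_space[OF Q that]] by linarith
  have abs_u: "(\<lambda>x. \<bar>u x\<bar>) \<in> borel_measurable (SA A)"
    using u by measurable
  note m = state_action_law_in_space[OF P \<pi> \<mu>]
  have m_le: "\<bar>\<integral>x. u x \<partial>?m t\<bar> \<le> (\<integral>x. \<bar>u x\<bar> \<partial>?m t)" for t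
    by (rule integral_abs_bound)
  have "(\<integral>x. \<bar>u x\<bar> \<partial>?m t) \<le> C" for t
    using abs_integral_prob_algebra_le[OF m abs_u, of C t] uB by simp
  then have le: "norm (\<gamma> ^ t * (\<integral>x. \<bar>u x\<bar> \<partial>?m t)) \<le> \<gamma> ^ t * C" for t
    using discount by (simp add: abs_mult mult_left_mono)
  have "summable (\<lambda>t. \<gamma> ^ t * C)"
    using discount by (intro summable_mult2 summable_geometric) simp
  then have sm: "summable (\<lambda>t. \<gamma> * (\<gamma> ^ t * (\<integral>x. \<bar>u x\<bar> \<partial>?m t)))"
    using le by (rule summable_mult[OF summable_comparison_test'])
  have "\<bar>policy_value A \<gamma> r \<mu> P \<pi> - policy_value A \<gamma> r \<mu> Q \<pi>\<bar>
      = norm (\<Sum>t. \<gamma> * (\<gamma> ^ t * (\<integral>x. u x \<partial>?m t)))"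
    using sums_unique[OF simulation_identity[OF P Q \<pi> \<mu>]] by (simp add: u_def)
  \<comment> \<open>Absolute values enter before coverage is used, because a comparison of measures
    controls only nonnegative integrands.\<close>
  also have "\<dots> \<le> (\<Sum>t. \<gamma> * (\<gamma> ^ t * (\<integral>x. \<bar>u x\<bar> \<partial>?m t)))"
    using discount m_le by (intro norm_suminf_le[OF _ sm]) (simp add: abs_mult mult_left_mono)
  also have "\<dots> = \<gamma> * (\<Sum>t. \<gamma> ^ t * (\<integral>x. \<bar>u x\<bar> \<partial>?m t))"
    using summable_mult_D[OF sm] discount by (intro suminf_mult) simp
  also have "\<dots> \<le> \<gamma> * (\<kappa> * (\<integral>x. \<bar>u x\<bar> \<partial>d))"
    using discount
    by (intro mult_left_mono discounted_integral_le_coverage(1)[OF _ _ P \<pi> \<mu> d coverage abs_u _ uB]) auto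
  also have "\<dots> \<le> \<gamma> * (\<kappa> * (L * e))"
  proof -
    have \<kappa>: "0 \<le> \<kappa>"
      using discount
      by (intro discounted_integral_le_coverage(2)[OF _ _ P \<pi> \<mu> d coverage abs_u _ uB]) auto
    have space_d: "space d = space (SA A)"
      using d sets_eq_imp_space_eq[of d "SA A"] by (simp add: space_prob_algebra)
    \<comment> \<open>For \<open>L = 0\<close> the critic V / L does not exist. But then V is
      constant, equal to its value at an arbitrary point, and two probability measures give a
      constant the same expectation, so both sides are 0.\<close>
    have "(\<integral>x. \<bar>u x\<bar> \<partial>d) \<le> L * e"
    proof (cases "L = 0")
      case True
      have "?V s = ?V undefined" for s
        using lipschitz_onD[OF lipschitz, of s undefined] True by simp
      then obtain c where const: "?V = (\<lambda>_. c)"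
        by blast
      have "\<bar>u x\<bar> = 0" if "x \<in> space d" for x
      proof -
        have "x \<in> space (SA A)"
          using that space_d by simp
        then have "prob_space (P x)" "prob_space (Q x)"
          using kernel_in_space[OF P, of x] kernel_in_space[OF Q, of x] by (simp_all add: space_prob_algebra)
        then show ?thesis
          unfolding u_def critic_gap_def const by (simp add: prob_space.prob_space)
      qed
      then have "(\<integral>x. \<bar>u x\<bar> \<partial>d) = (\<integral>x. 0 \<partial>d)"
        by (intro Bochner_Integration.integral_cong) auto
      then show ?thesis
        using True by simp
    next
      case False
      then have L: "0 < L"
        using lipschitz_on_nonneg[OF lipschitz] by simp
      have "ereal (\<integral>x. \<bar>u x\<bar> / L \<partial>d) \<le> expect d (sup_gap P Q lip_critics)"
      proof (rule expect_ge_integral)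
        show "integrable d (\<lambda>x. \<bar>u x\<bar> / L)"
          using integrable_prob_algebra_bounded[OF d u uB] by simp
        show "ereal (\<bar>u x\<bar> / L) \<le> sup_gap P Q lip_critics x" if "x \<in> space d" for x
          unfolding u_def using that space_d
          by (intro abs_critic_gap_le_sup_gap[OF measurable_value_fun[OF Q \<pi>] abs_value_fun_le[OF Q \<pi>]
                lipschitz L] kernel_in_space P Q) simp_all
      qed (use L in simp)
      also note gap
      finally show ?thesis
        using L by (simp add: field_simps)
    qed
    then show ?thesis
      using \<kappa> discount by (intro mult_left_mono) auto
  qed
  finally show ?thesis
    by (simp add: mult_ac)
qed

theorem theorem6:
  fixes A :: "'a measure"
    and P Pstar :: "('s::metric_space, 'a) kernel"
    and r :: "'s \<times> 'a \<Rightarrow> real"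
    and \<rho>\<^sub>0 :: "'s measure"
    and d_data :: "('s \<times> 'a) measure"
    and Policies :: "('s, 'a) policy set"
    and \<M> :: "('s, 'a) kernel set"
    and D_Lip :: "('s, 'a) critic set"
    and \<gamma> R_max \<kappa> L\<^sub>v \<epsilon>_model \<epsilon>_critic :: real
  assumes discount: "0 < \<gamma>" "\<gamma> < 1"
    and true_kernel: "is_kernel A P"
    and reward: "r \<in> borel_measurable (SA A)" "\<forall>x\<in>space (SA A). 0 \<le> r x \<and> r x \<le> R_max"
    and initial: "\<rho>\<^sub>0 \<in> space (prob_algebra borel)"
    and policies: "\<forall>\<pi>\<in>Policies. is_policy A \<pi>"
    and models: "\<forall>Q\<in>\<M>. is_kernel A Q"
    and data: "d_data \<in> space (prob_algebra (SA A))"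
    and coverage: "\<forall>\<pi>\<in>Policies. \<forall>B\<in>sets (SA A). occupancy A \<gamma> \<rho>\<^sub>0 P \<pi> B \<le> \<kappa> * measure d_data B"
    and lipschitz: "\<forall>Q\<in>\<M>. \<forall>\<pi>\<in>Policies. L\<^sub>v-lipschitz_on UNIV (value_fun A \<gamma> r Q \<pi>)"
    and critic_nonneg: "0 \<le> \<epsilon>_critic"
    and critic_error:
      "\<forall>Q\<in>\<M>. expect d_data (sup_gap P Q lip_critics) \<le> game_value d_data P D_Lip Q + ereal \<epsilon>_critic"
    and optimum: "Pstar \<in> \<M>" "game_value d_data P D_Lip Pstar \<le> ereal \<epsilon>_model"
  shows "(SUP \<pi>\<in>Policies. ereal \<bar>policy_value A \<gamma> r \<rho>\<^sub>0 P \<pi> - policy_value A \<gamma> r \<rho>\<^sub>0 Pstar \<pi>\<bar>)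
    \<le> ereal (\<gamma> * L\<^sub>v * \<kappa> * (\<epsilon>_model + \<epsilon>_critic))"
proof (rule SUP_least)
  \<comment> \<open>The bound is uniform in the policy. The supremum lives in \<open>ereal\<close>,
    so an empty policy class gives minus infinity and needs no separate case.\<close>
  fix \<pi> assume \<pi>: "\<pi> \<in> Policies"
  interpret discounted_mdp A \<gamma> r R_max
    using discount reward by unfold_locales auto
  have "expect d_data (sup_gap P Pstar lip_critics) \<le> game_value d_data P D_Lip Pstar + ereal \<epsilon>_critic"
    using critic_error optimum(1) by blast
  also have "\<dots> \<le> ereal (\<epsilon>_model + \<epsilon>_critic)"
    using add_right_mono[OF optimum(2), of "ereal \<epsilon>_critic"] by simp
  finally have "\<bar>policy_value A \<gamma> r \<rho>\<^sub>0 P \<pi> - policy_value A \<gamma> r \<rho>\<^sub>0 Pstar \<pi>\<bar>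
      \<le> \<gamma> * L\<^sub>v * \<kappa> * (\<epsilon>_model + \<epsilon>_critic)"
    using \<pi> true_kernel models optimum(1) policies initial data coverage lipschitz
    by (intro abs_policy_value_diff_le) auto
  then show "ereal \<bar>policy_value A \<gamma> r \<rho>\<^sub>0 P \<pi> - policy_value A \<gamma> r \<rho>\<^sub>0 Pstar \<pi>\<bar>
      \<le> ereal (\<gamma> * L\<^sub>v * \<kappa> * (\<epsilon>_model + \<epsilon>_critic))"
    by simp
qed

end
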